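(* The span of the elements $\mathbf{F}_{(\mathbf{a},u)}$ indexed by level $2$ parking functions $(\mathbf{a},u)$ is a subalgebra (for the product of the $\mathbf{F}$ basis). The span of the elements $\mathbf{G}_{(\mathbf{a},u)}$ indexed by level $2$ parking functions $(\mathbf{a},u)$ is a subcoalgebra of $\mathbf{PQSym}^{(2)}$.
   Context: A parking function of length $n$ is a word $\mathbf{a}=a_1\cdots a_n$ on $\{1,\ldots,n\}$ whose nondecreasing rearrangement $a_1'\cdots a_n'$ satisfies $a_i'\le i$. A $2$-colored parking function is a pair $(\mathbf{a},u)$ of a parking function and a word $u$ of the same length over the colors $0<1$. One says that $\mathbf{a}$ has a match at $b$ if $|\{i:a_i<b\}|=b-1$ and $|\{i:a_i\le b\}|\ge b$. A $2$-colored parking function $(\mathbf{a},u)$ is a level $2$ parking function if: (i) the only letters of $\mathbf{a}$ that can have color $1$ are the matches of $\mathbf{a}$; (ii) for every letter of $\mathbf{a}$ of color $1$, all the letters equal to it and to its left also have color $1$; (iii) every value occurring in $\mathbf{a}$ has color $0$ at least once. $\mathbf{PQSym}^{(2)}$ has basis $\mathbf{G}_{(\mathbf{a},u)}$ indexed by all $2$-colored parking functions, with coproduct $$\Delta\mathbf{G}_{(\mathbf{a},u)}=\sum_{(\mathbf{a},u)\in(\mathbf{a}',u')\Cup(\mathbf{a}'',u'')}\mathbf{G}_{(\mathbf{a}',u')}\otimes\mathbf{G}_{(\mathbf{a}'',u'')},$$ where $(\mathbf{a}',u')\Cup(\mathbf{a}'',u'')$ is the shifted shuffle: the shuffle of the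 words of biletters $(\mathbf{a}',u')$ and $(\mathbf{a}''[k],u'')$, $k=|\mathbf{a}'|$, with $\mathbf{a}''[k]$ obtained by adding $k$ to each letter of $\mathbf{a}''$ (colors follow their letters). The $\mathbf{F}_{(\mathbf{a},u)}$ form the dual basis of the $\mathbf{G}_{(\mathbf{a},u)}$ in the graded dual $(\mathbf{PQSym}^{(2)})^*$, with product $$\mathbf{F}_{(\mathbf{a}',u')}\mathbf{F}_{(\mathbf{a}'',u'')}=\sum_{(\mathbf{a},u)\in(\mathbf{a}',u')\Cup(\mathbf{a}'',u'')}\mathbf{F}_{(\mathbf{a},u)}.$$ *)

theory Defs
  imports Complex_Main "HOL-Library.Poly_Mapping" "HOL-Library.Function_Algebras"
    "HOL-Library.Multiset"
begin

definition parking_function :: "nat list \<Rightarrow> bool" where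
  "parking_function a \<longleftrightarrow>
     set a \<subseteq> {1..length a} \<and> (\<forall>i<length a. sort a ! i \<le> Suc i)"

text \<open>The first equation is \<open>|{i. a\<^sub>i < b}| = b - 1\<close>, written without truncated subtraction
  (so that \<open>0\<close> is never a match).\<close>

definition match_at :: "nat list \<Rightarrow> nat \<Rightarrow> bool" where
  "match_at a b \<longleftrightarrow>
     card {i. i < length a \<and> a ! i < b} + 1 = b \<and> card {i. i < length a \<and> a ! i \<le> b} \<ge> b"

typedef colored_pf =
  "{(a :: nat list, u :: nat list). parking_function a \<and> length u = length a \<and> set u \<subseteq> {0, 1}}"
  by (rule exI[of _ "([], [])"]) (simp add: parking_function_def)

abbreviation word_of :: "colored_pf \<Rightarrow> nat list" where
  "word_of x \<equiv> fst (Rep_colored_pf x)"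

abbreviation color_of :: "colored_pf \<Rightarrow> nat list" where
  "color_of x \<equiv> snd (Rep_colored_pf x)"

definition level2_word :: "nat list \<Rightarrow> nat list \<Rightarrow> bool" where
  "level2_word a u \<longleftrightarrow>
     (\<forall>i<length a. u ! i = 1 \<longrightarrow> match_at a (a ! i)) \<and>
     (\<forall>i<length a. u ! i = 1 \<longrightarrow> (\<forall>j<i. a ! j = a ! i \<longrightarrow> u ! j = 1)) \<and>
     (\<forall>b\<in>set a. \<exists>i<length a. a ! i = b \<and> u ! i = 0)"

definition level2 :: "colored_pf \<Rightarrow> bool" where
  "level2 x \<longleftrightarrow> level2_word (word_of x) (color_of x)"

text \<open>Shuffles are taken as a set of words: the letters of the first word are at most \<open>k\<close> and
  those of the shifted second word exceed \<open>k\<close>, so no word arises from two different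
  interleavings.\<close>

definition shifted_shuffle ::
    "nat list \<times> nat list \<Rightarrow> nat list \<times> nat list \<Rightarrow> (nat list \<times> nat list) set" where
  "shifted_shuffle = (\<lambda>(a', u') (a'', u'').
     (\<lambda>w. (map fst w, map snd w)) `
       shuffles (zip a' u') (zip (map (\<lambda>b. b + length a') a'') u''))"

definition pf_shuffle :: "colored_pf \<Rightarrow> colored_pf \<Rightarrow> colored_pf set" where
  "pf_shuffle x y = {z. Rep_colored_pf z \<in> shifted_shuffle (Rep_colored_pf x) (Rep_colored_pf y)}"

text \<open>The coalgebra \<open>PQSym(2)\<close> over the field \<open>'k\<close>: the vector space with basis \<open>G x\<close>. Its tensor square has
  the basis of pairs, \<open>(x, y)\<close> standing for \<open>G x \<otimes> G y\<close>.\<close>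

type_synonym 'k pqsym2 = "colored_pf \<Rightarrow>\<^sub>0 'k"
type_synonym 'k pqsym2_tensor = "(colored_pf \<times> colored_pf) \<Rightarrow>\<^sub>0 'k"
type_synonym 'k pqsym2_dual = "'k pqsym2 \<Rightarrow> 'k"

definition pm_scale :: "'k::field \<Rightarrow> ('b \<Rightarrow>\<^sub>0 'k) \<Rightarrow> ('b \<Rightarrow>\<^sub>0 'k)" where
  "pm_scale c v = Poly_Mapping.map ((*) c) v"

definition fun_scale :: "'k::field \<Rightarrow> ('b \<Rightarrow> 'k) \<Rightarrow> ('b \<Rightarrow> 'k)" where
  "fun_scale c f = (\<lambda>v. c * f v)"

lemma lookup_pm_scale [simp]: "Poly_Mapping.lookup (pm_scale c v) x = c * Poly_Mapping.lookup v x"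
  by (simp add: pm_scale_def Poly_Mapping.map.rep_eq when_def)

global_interpretation pm: vector_space "pm_scale :: 'k::field \<Rightarrow> ('b \<Rightarrow>\<^sub>0 'k) \<Rightarrow> ('b \<Rightarrow>\<^sub>0 'k)"
  by unfold_locales (auto intro!: poly_mapping_eqI simp: lookup_add algebra_simps)

global_interpretation dual: vector_space "fun_scale :: 'k::field \<Rightarrow> ('b \<Rightarrow> 'k) \<Rightarrow> ('b \<Rightarrow> 'k)"
  by unfold_locales (auto simp: fun_scale_def algebra_simps)

definition G :: "colored_pf \<Rightarrow> 'k::field pqsym2" where
  "G x = Poly_Mapping.single x 1"

definition tensor :: "'k::field pqsym2 \<Rightarrow> 'k pqsym2 \<Rightarrow> 'k pqsym2_tensor" where
  "tensor v w =
     (\<Sum>x\<in>Poly_Mapping.keys v. \<Sum>y\<in>Poly_Mapping.keys w.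
        Poly_Mapping.single (x, y) (Poly_Mapping.lookup v x * Poly_Mapping.lookup w y))"

definition coproduct_G :: "colored_pf \<Rightarrow> 'k::field pqsym2_tensor" where
  "coproduct_G x = (\<Sum>(y, z)\<in>{(y, z). x \<in> pf_shuffle y z}. tensor (G y) (G z))"

definition coproduct :: "'k::field pqsym2 \<Rightarrow> 'k pqsym2_tensor" where
  "coproduct v = (\<Sum>x\<in>Poly_Mapping.keys v. pm_scale (Poly_Mapping.lookup v x) (coproduct_G x))"

definition subcoalgebra :: "'k::field pqsym2 set \<Rightarrow> bool" where
  "subcoalgebra C \<longleftrightarrow>
     pm.subspace C \<and> (\<forall>v\<in>C. coproduct v \<in> pm.span {tensor c d | c d. c \<in> C \<and> d \<in> C})"

text \<open>The homogeneous components are finite dimensional, so a functional belongs to the direct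
  sum of their duals iff it is zero in all sufficiently large degrees.\<close>

definition graded_dual :: "'k::field pqsym2_dual set" where
  "graded_dual = {f. Vector_Spaces.linear pm_scale (*) f \<and>
                     (\<exists>n. \<forall>x. n \<le> length (word_of x) \<longrightarrow> f (G x) = 0)}"

definition F :: "colored_pf \<Rightarrow> 'k::field pqsym2_dual" where
  "F x = (\<lambda>v. Poly_Mapping.lookup v x)"

definition tensor_functional ::
    "'k::field pqsym2_dual \<Rightarrow> 'k pqsym2_dual \<Rightarrow> 'k pqsym2_tensor \<Rightarrow> 'k" where
  "tensor_functional f g t = (\<Sum>(x, y)\<in>Poly_Mapping.keys t.
     Poly_Mapping.lookup t (x, y) * (f (G x) * g (G y)))"

text \<open>The product of the graded dual is the transpose of the coproduct; lemma \<open>F_product\<close> below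
  computes it on the basis \<open>F\<close>.\<close>

definition dual_mult :: "'k::field pqsym2_dual \<Rightarrow> 'k pqsym2_dual \<Rightarrow> 'k pqsym2_dual" where
  "dual_mult f g = (\<lambda>v. tensor_functional f g (coproduct v))"

definition empty_pf :: colored_pf where
  "empty_pf = Abs_colored_pf ([], [])"

definition dual_one :: "'k::field pqsym2_dual" where
  "dual_one = F empty_pf"

definition dual_subalgebra :: "'k::field pqsym2_dual set \<Rightarrow> bool" where
  "dual_subalgebra A \<longleftrightarrow>
     A \<subseteq> graded_dual \<and> dual.subspace A \<and> dual_one \<in> A \<and> (\<forall>f\<in>A. \<forall>g\<in>A. dual_mult f g \<in> A)"

subsection \<open>Basic facts\<close>

lemma keys_G [simp]: "Poly_Mapping.keys (G x :: 'k::field pqsym2) = {x}"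
  by (simp add: G_def)

lemma lookup_G: "Poly_Mapping.lookup (G x :: 'k::field pqsym2) y = (if x = y then 1 else 0)"
  by (simp add: G_def lookup_single when_def)

lemma tensor_G: "tensor (G x) (G y) = (Poly_Mapping.single (x, y) 1 :: 'k::field pqsym2_tensor)"
  by (simp add: tensor_def lookup_G)

lemma coproduct_of_G: "coproduct (G x) = (coproduct_G x :: 'k::field pqsym2_tensor)"
  by (simp add: coproduct_def lookup_G)

lemma F_G: "F x (G y :: 'k::field pqsym2) = (if x = y then 1 else 0)"
  by (simp add: F_def lookup_G)

lemma mset_of_shuffle: "zs \<in> shuffles xs ys \<Longrightarrow> mset zs = mset xs + mset ys"
  by (induction xs ys arbitrary: zs rule: shuffles.induct) auto

lemma parking_function_shift_append:
  assumes "parking_function a" "parking_function b"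
    and c: "mset c = mset a + mset (map (\<lambda>x. x + length a) b)"
  shows "parking_function c"
proof -
  let ?b = "map (\<lambda>x. x + length a) b"
  have len: "length c = length a + length b"
    using arg_cong[OF c, of size] by simp
  have set: "set c = set a \<union> set ?b"
    using arg_cong[OF c, of set_mset] by simp
  have mono: "sorted (map (\<lambda>x. x + length a) (sort b))"
    by (simp add: sorted_map sorted_wrt_mono_rel[OF _ sorted_sort])
  have "sort c = sort a @ map (\<lambda>x. x + length a) (sort b)"
    using assms mono
    by (intro properties_for_sort) (auto simp: c sorted_append parking_function_def)
  then have "sort c ! i \<le> Suc i" if "i < length c" for i
  proof (cases "i < length a")
    case True
    then show ?thesis
      using assms(1) \<open>sort c = _\<close> by (simp add: parking_function_def nth_append)
  next
    case False
    then have "i - length a < length b" using that len by simp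
    then have "sort b ! (i - length a) \<le> Suc (i - length a)"
      using assms(2) by (simp add: parking_function_def)
    then show ?thesis
      using False \<open>i - length a < length b\<close> \<open>sort c = _\<close> by (simp add: nth_append)
  qed
  moreover have "set c \<subseteq> {1..length c}"
  proof -
    have "set a \<subseteq> {1..length a}" "set b \<subseteq> {1..length b}"
      using assms(1,2) by (simp_all add: parking_function_def)
    then have "\<forall>x\<in>set a. 1 \<le> x \<and> x \<le> length a" "\<forall>x\<in>set b. 1 \<le> x \<and> x \<le> length b"
      by (metis atLeastAtMost_iff subsetD)+
    then show ?thesis unfolding set len by fastforce
  qed
  ultimately show ?thesis by (simp add: parking_function_def)
qed

lemma shifted_shuffle_colored_pf:
  assumes "w \<in> shifted_shuffle (Rep_colored_pf x) (Rep_colored_pf y)"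
  shows "w \<in> range Rep_colored_pf"
proof -
  obtain a u where x: "Rep_colored_pf x = (a, u)" by fastforce
  obtain b v where y: "Rep_colored_pf y = (b, v)" by fastforce
  have xp: "parking_function a" "length u = length a" "set u \<subseteq> {0, 1}"
    using Rep_colored_pf[of x] x by auto
  have yp: "parking_function b" "length v = length b" "set v \<subseteq> {0, 1}"
    using Rep_colored_pf[of y] y by auto
  obtain z where z: "w = (map fst z, map snd z)"
      "z \<in> shuffles (zip a u) (zip (map (\<lambda>t. t + length a) b) v)"
    using assms by (auto simp: x y shifted_shuffle_def)
  have m: "mset z = mset (zip a u) + mset (zip (map (\<lambda>t. t + length a) b) v)"
    using z(2) by (rule mset_of_shuffle)
  have "mset (map fst z) = mset (map fst (zip a u)) + mset (map fst (zip (map (\<lambda>t. t + length a) b) v))"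
    by (simp only: mset_map m image_mset_union)
  then have "parking_function (map fst z)"
    using parking_function_shift_append[OF xp(1) yp(1)] xp yp by simp
  moreover have "set (map snd z) = set u \<union> set v"
  proof -
    have "mset (map snd z) = mset (map snd (zip a u)) + mset (map snd (zip (map (\<lambda>t. t + length a) b) v))"
      by (simp only: mset_map m image_mset_union)
    then have "mset (map snd z) = mset u + mset v" using xp yp by simp
    from arg_cong[OF this, of set_mset] show ?thesis by simp
  qed
  ultimately show ?thesis
    using z(1) xp yp by (simp add: type_definition.Rep_range[OF type_definition_colored_pf])
qed

lemma Rep_pf_shuffle:
  "Rep_colored_pf ` pf_shuffle x y = shifted_shuffle (Rep_colored_pf x) (Rep_colored_pf y)"
proof
  show "shifted_shuffle (Rep_colored_pf x) (Rep_colored_pf y) \<subseteq> Rep_colored_pf ` pf_shuffle x y"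
  proof
    fix w assume w: "w \<in> shifted_shuffle (Rep_colored_pf x) (Rep_colored_pf y)"
    then obtain z where "w = Rep_colored_pf z" using shifted_shuffle_colored_pf by blast
    with w show "w \<in> Rep_colored_pf ` pf_shuffle x y" by (simp add: pf_shuffle_def)
  qed
qed (auto simp: pf_shuffle_def)

lemma finite_pf_shuffle: "finite (pf_shuffle x y)"
proof -
  have "finite (Rep_colored_pf ` pf_shuffle x y)"
    by (simp add: Rep_pf_shuffle shifted_shuffle_def split: prod.split)
  then show ?thesis
    by (rule finite_imageD) (simp add: inj_on_def Rep_colored_pf_inject)
qed

lemma length_word_of_pf_shuffle:
  assumes "z \<in> pf_shuffle x y"
  shows "length (word_of z) = length (word_of x) + length (word_of y)"
proof -
  obtain w where w: "Rep_colored_pf z = (map fst w, map snd w)"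
      "w \<in> shuffles (zip (word_of x) (color_of x))
                   (zip (map (\<lambda>t. t + length (word_of x)) (word_of y)) (color_of y))"
    using assms by (auto simp: pf_shuffle_def shifted_shuffle_def split_def)
  have "length (color_of x) = length (word_of x)" "length (color_of y) = length (word_of y)"
    using Rep_colored_pf[of x] Rep_colored_pf[of y] by auto
  then show ?thesis using length_shuffles[OF w(2)] w(1) by simp
qed

lemma finite_colored_pf_length_le: "finite {x. length (word_of x) \<le> n}"
proof -
  have "Rep_colored_pf ` {x. length (word_of x) \<le> n} \<subseteq>
      {a. set a \<subseteq> {0..n} \<and> length a \<le> n} \<times> {u. set u \<subseteq> {0, 1} \<and> length u \<le> n}"
  proof
    fix p assume "p \<in> Rep_colored_pf ` {x. length (word_of x) \<le> n}"
    then obtain x where x: "p = Rep_colored_pf x" "length (word_of x) \<le> n" by auto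
    then show "p \<in> {a. set a \<subseteq> {0..n} \<and> length a \<le> n} \<times> {u. set u \<subseteq> {0, 1} \<and> length u \<le> n}"
      using Rep_colored_pf[of x] by (cases p) (force simp: parking_function_def)
  qed
  then have "finite (Rep_colored_pf ` {x. length (word_of x) \<le> n})"
    by (rule finite_subset) (intro finite_cartesian_product finite_lists_length_le; simp)
  then show ?thesis
    by (rule finite_imageD) (simp add: inj_on_def Rep_colored_pf_inject)
qed

lemma finite_pf_unshuffle: "finite {(y, z). x \<in> pf_shuffle y z}"
  by (rule finite_subset[of _ "{y. length (word_of y) \<le> length (word_of x)} \<times>
                               {z. length (word_of z) \<le> length (word_of x)}"])
     (auto simp: finite_colored_pf_length_le dest: length_word_of_pf_shuffle)

lemma lookup_coproduct_G:
  "Poly_Mapping.lookup (coproduct_G x :: 'k::field pqsym2_tensor) (y, z) = (if x \<in> pf_shuffle y z then 1 else 0)"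
proof -
  have "Poly_Mapping.lookup (coproduct_G x :: 'k pqsym2_tensor) (y, z) =
      (\<Sum>p\<in>{(y, z). x \<in> pf_shuffle y z}. if p = (y, z) then 1 else 0)"
    by (simp add: coproduct_G_def lookup_sum tensor_G lookup_single when_def split_def)
  then show ?thesis by (simp add: finite_pf_unshuffle)
qed

lemma lookup_coproduct:
  "Poly_Mapping.lookup (coproduct v :: 'k::field pqsym2_tensor) (y, z) = (\<Sum>x\<in>pf_shuffle y z. Poly_Mapping.lookup v x)"
proof -
  have "Poly_Mapping.lookup (coproduct v :: 'k pqsym2_tensor) (y, z) =
      (\<Sum>x\<in>Poly_Mapping.keys v. if x \<in> pf_shuffle y z then Poly_Mapping.lookup v x else 0)"
    by (auto simp: coproduct_def lookup_sum lookup_coproduct_G intro!: sum.cong)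
  also have "\<dots> = (\<Sum>x\<in>Poly_Mapping.keys v \<inter> pf_shuffle y z. Poly_Mapping.lookup v x)"
    by (simp add: sum.inter_restrict)
  also have "\<dots> = (\<Sum>x\<in>pf_shuffle y z. Poly_Mapping.lookup v x)"
    by (rule sum.mono_neutral_left) (auto simp: finite_pf_shuffle in_keys_iff)
  finally show ?thesis .
qed

lemma sum_apply: "(\<Sum>x\<in>A. f x) v = (\<Sum>x\<in>A. f x v)"
  by (induction A rule: infinite_finite_induct) auto

lemma F_product:
  "dual_mult (F x) (F y) = (\<Sum>z\<in>pf_shuffle x y. F z :: 'k::field pqsym2_dual)"
proof
  fix v :: "'k pqsym2"
  have "dual_mult (F x) (F y) v =
      (\<Sum>p\<in>Poly_Mapping.keys (coproduct v). if p = (x, y) then Poly_Mapping.lookup (coproduct v) (x, y) else 0)"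
    unfolding dual_mult_def tensor_functional_def
    by (rule sum.cong) (auto simp: F_G split: if_splits)
  also have "\<dots> = Poly_Mapping.lookup (coproduct v) (x, y)"
    by (simp add: in_keys_iff)
  finally show "dual_mult (F x) (F y) v = (\<Sum>z\<in>pf_shuffle x y. F z) v"
    by (simp add: lookup_coproduct sum_apply F_def)
qed

lemma Rep_empty_pf: "Rep_colored_pf empty_pf = ([], [])"
  by (simp add: empty_pf_def Abs_colored_pf_inverse parking_function_def)

lemma pf_shuffle_empty: "pf_shuffle empty_pf x = {x}" "pf_shuffle x empty_pf = {x}"
proof -
  have "length (color_of x) = length (word_of x)" using Rep_colored_pf[of x] by auto
  then have "Rep_colored_pf ` pf_shuffle empty_pf x = {Rep_colored_pf x}"
    "Rep_colored_pf ` pf_shuffle x empty_pf = {Rep_colored_pf x}"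
    unfolding Rep_pf_shuffle by (simp_all add: Rep_empty_pf shifted_shuffle_def split_def)
  then show "pf_shuffle empty_pf x = {x}" "pf_shuffle x empty_pf = {x}"
    using inj_image_eq_iff[of Rep_colored_pf _ "{x}"] by (auto simp: inj_on_def Rep_colored_pf_inject)
qed

lemma dual_one_mult_F:
  "dual_mult dual_one (F x) = (F x :: 'k::field pqsym2_dual)"
  "dual_mult (F x) dual_one = (F x :: 'k::field pqsym2_dual)"
  by (simp_all add: dual_one_def F_product pf_shuffle_empty)

lemma expand_G: "v = (\<Sum>x\<in>Poly_Mapping.keys v. pm_scale (Poly_Mapping.lookup v x) (G x :: 'k::field pqsym2))"
proof (rule poly_mapping_eqI)
  fix y
  have "Poly_Mapping.lookup (\<Sum>x\<in>Poly_Mapping.keys v. pm_scale (Poly_Mapping.lookup v x) (G x)) y =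
      (\<Sum>x\<in>Poly_Mapping.keys v. if x = y then Poly_Mapping.lookup v y else 0)"
    unfolding lookup_sum lookup_pm_scale lookup_G by (rule sum.cong) auto
  then show "Poly_Mapping.lookup v y = Poly_Mapping.lookup (\<Sum>x\<in>Poly_Mapping.keys v. pm_scale (Poly_Mapping.lookup v x) (G x)) y"
    by (simp add: in_keys_iff)
qed

lemma linear_expand_G:
  assumes "Vector_Spaces.linear pm_scale (*) (f :: 'k::field pqsym2_dual)"
  shows "f v = (\<Sum>x\<in>Poly_Mapping.keys v. Poly_Mapping.lookup v x * f (G x))"
proof -
  interpret f: Vector_Spaces.linear pm_scale "(*)" f by fact
  show ?thesis by (subst expand_G) (simp add: f.sum f.scale)
qed

lemma F_in_graded_dual: "(F x :: 'k::field pqsym2_dual) \<in> graded_dual"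
proof -
  have "vector_space ((*) :: 'k \<Rightarrow> 'k \<Rightarrow> 'k)"
    by unfold_locales (auto simp: algebra_simps)
  then have "Vector_Spaces.linear pm_scale (*) (F x :: 'k pqsym2_dual)"
    by (simp add: Vector_Spaces.linear_iff pm.vector_space_axioms F_def lookup_add)
  moreover have "\<forall>y. Suc (length (word_of x)) \<le> length (word_of y) \<longrightarrow> F x (G y :: 'k pqsym2) = 0"
    by (auto simp: F_G)
  ultimately show ?thesis by (auto simp: graded_dual_def)
qed

lemma subspace_graded_dual: "dual.subspace (graded_dual :: 'k::field pqsym2_dual set)"
proof -
  have vs: "vector_space ((*) :: 'k \<Rightarrow> 'k \<Rightarrow> 'k)"
    by unfold_locales (auto simp: algebra_simps)
  interpret vp: vector_space_pair "pm_scale :: 'k \<Rightarrow> 'k pqsym2 \<Rightarrow> _" "(*) :: 'k \<Rightarrow> 'k \<Rightarrow> 'k"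
    using vs by (simp add: vector_space_pair_def pm.vector_space_axioms)
  show ?thesis
  proof (rule dual.subspaceI)
    show "(0 :: 'k pqsym2_dual) \<in> graded_dual"
      using vp.linear_zero by (simp add: graded_dual_def zero_fun_def)
  next
    fix f g :: "'k pqsym2_dual" assume "f \<in> graded_dual" "g \<in> graded_dual"
    then obtain m n where fg:
        "Vector_Spaces.linear pm_scale (*) f" "Vector_Spaces.linear pm_scale (*) g"
        "\<forall>x. m \<le> length (word_of x) \<longrightarrow> f (G x) = 0" "\<forall>x. n \<le> length (word_of x) \<longrightarrow> g (G x) = 0"
      by (auto simp: graded_dual_def)
    then have "\<forall>x. max m n \<le> length (word_of x) \<longrightarrow> (f + g) (G x) = 0" by simp
    moreover have "Vector_Spaces.linear pm_scale (*) (f + g)"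
      using vp.linear_compose_add[OF fg(1,2)] by (simp add: plus_fun_def)
    ultimately show "f + g \<in> graded_dual" unfolding graded_dual_def by blast
  next
    fix c and f :: "'k pqsym2_dual" assume "f \<in> graded_dual"
    then show "fun_scale c f \<in> graded_dual"
      using vp.linear_compose_scale_right[of f c] by (auto simp: graded_dual_def fun_scale_def)
  qed
qed

lemma graded_dual_eq_span: "graded_dual = dual.span (range (F :: colored_pf \<Rightarrow> 'k::field pqsym2_dual))"
proof
  show "graded_dual \<subseteq> dual.span (range (F :: _ \<Rightarrow> 'k pqsym2_dual))"
  proof
    fix f :: "'k pqsym2_dual" assume "f \<in> graded_dual"
    then obtain n where lin: "Vector_Spaces.linear pm_scale (*) f"
        and n: "\<And>x. n \<le> length (word_of x) \<Longrightarrow> f (G x) = 0"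
      by (auto simp: graded_dual_def)
    let ?S = "{x. length (word_of x) \<le> n}"
    have "f = (\<Sum>x\<in>?S. fun_scale (f (G x)) (F x))"
    proof
      fix v
      have "f v = (\<Sum>x\<in>Poly_Mapping.keys v \<union> ?S. Poly_Mapping.lookup v x * f (G x))"
        unfolding linear_expand_G[OF lin, of v]
        by (rule sum.mono_neutral_left) (auto simp: finite_colored_pf_length_le in_keys_iff)
      also have "\<dots> = (\<Sum>x\<in>?S. Poly_Mapping.lookup v x * f (G x))"
        by (rule sum.mono_neutral_right) (auto simp: finite_colored_pf_length_le n)
      finally show "f v = (\<Sum>x\<in>?S. fun_scale (f (G x)) (F x)) v"
        by (simp add: sum_apply fun_scale_def F_def mult.commute)
    qed
    then show "f \<in> dual.span (range F)"
      by (metis (no_types, lifting) dual.span_sum dual.span_scale dual.span_base rangeI)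
  qed
  show "dual.span (range F) \<subseteq> (graded_dual :: 'k pqsym2_dual set)"
    by (rule dual.span_minimal) (auto simp: F_in_graded_dual subspace_graded_dual)
qed

end

(* Everything rests on one equivalence: a shifted shuffle of x and y is level 2 iff both x and y are.
   With k the length of x, letters up to k come from x and letters above k from y, so for b up to k
   the matches at b are those of x, while for b = c + k exactly k further letters lie below b and the
   matches at b are those of y at c. Equal letters come from the same factor, in the same order.
   The direction from the factors to the shuffle gives the subalgebra, the converse gives the
   subcoalgebra. *)

theory Submission
  imports Defs
begin

text \<open>Counting positions amounts to counting letters with multiplicity, so matches do not
  depend on the interleaving chosen by a shuffle.\<close>

lemma match_at_mset:
  "match_at a b \<longleftrightarrow>
     size (filter_mset (\<lambda>x. x < b) (mset a)) + 1 = b \<and> size (filter_mset (\<lambda>x. x \<le> b) (mset a)) \<ge> b"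
  by (simp add: match_at_def length_filter_conv_card flip: mset_filter)

text \<open>Indices are avoided because a shuffle moves positions: the first and third conditions
  see only letters, and the second only the relative order of two letters, hence
  \<open>sorted_wrt\<close>.\<close>

definition level2_biword :: "(nat \<times> nat) list \<Rightarrow> bool" where
  "level2_biword w \<longleftrightarrow>
     (\<forall>p\<in>set w. snd p = 1 \<longrightarrow> match_at (map fst w) (fst p)) \<and>
     sorted_wrt (\<lambda>p q. fst p = fst q \<longrightarrow> snd q = 1 \<longrightarrow> snd p = 1) w \<and>
     (\<forall>p\<in>set w. (fst p, 0) \<in> set w)"

lemma level2_word_iff_biword: "level2_word (map fst w) (map snd w) \<longleftrightarrow> level2_biword w"
proof -
  have "(\<forall>i<length w. snd (w ! i) = 1 \<longrightarrow> (\<forall>j<i. fst (w ! j) = fst (w ! i) \<longrightarrow> snd (w ! j) = 1)) \<longleftrightarrow>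
      sorted_wrt (\<lambda>p q. fst p = fst q \<longrightarrow> snd q = 1 \<longrightarrow> snd p = 1) w"
    unfolding sorted_wrt_iff_nth_less by blast
  moreover have "(\<exists>i<length w. fst (w ! i) = b \<and> snd (w ! i) = 0) \<longleftrightarrow> (b, 0) \<in> set w" for b
    by (auto simp: in_set_conv_nth prod_eq_iff)
  ultimately show ?thesis
    by (simp add: level2_word_def level2_biword_def all_set_conv_all_nth cong: conj_cong)
qed

text \<open>A shuffle keeps the order within each factor, and a pair from different factors
  satisfies \<open>R\<close> whichever letter comes first.\<close>

lemma sorted_wrt_shuffles:
  assumes "zs \<in> shuffles xs ys" "\<And>x y. x \<in> set xs \<Longrightarrow> y \<in> set ys \<Longrightarrow> R x y \<and> R y x"
  shows "sorted_wrt R zs \<longleftrightarrow> sorted_wrt R xs \<and> sorted_wrt R ys"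
  using assms
proof (induction xs ys arbitrary: zs rule: shuffles.induct)
  case (3 x xs y ys)
  from "3.prems"(1) consider
      zs' where "zs = x # zs'" "zs' \<in> shuffles xs (y # ys)"
    | zs' where "zs = y # zs'" "zs' \<in> shuffles (x # xs) ys"
    by auto
  then show ?case
  proof cases
    case 1
    then have "sorted_wrt R zs' \<longleftrightarrow> sorted_wrt R xs \<and> sorted_wrt R (y # ys)"
      using "3.IH"(1) "3.prems"(2) by simp
    then show ?thesis
      \<comment> \<open>The letters after the head \<open>x\<close> are those of \<open>xs\<close>,
        as in the factor of \<open>x\<close>, and those of \<open>y # ys\<close>, which the
        hypothesis on mixed pairs settles.\<close>
      using 1 set_shuffles[OF 1(2)] "3.prems"(2) by auto
  next
    case 2
    then have "sorted_wrt R zs' \<longleftrightarrow> sorted_wrt R (x # xs) \<and> sorted_wrt R ys"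
      using "3.IH"(2) "3.prems"(2) by simp
    then show ?thesis
      using 2 set_shuffles[OF 2(2)] "3.prems"(2) by auto
  qed
qed auto

text \<open>Letters of \<open>a'\<close> are at least 1, so once shifted they exceed
  \<open>length a\<close>, hence \<open>b\<close>, and add nothing to either count.\<close>

lemma match_at_shift_left:
  assumes "mset c = mset a + mset (map (\<lambda>x. x + length a) a')" "0 \<notin> set a'" "b \<le> length a"
  shows "match_at c b \<longleftrightarrow> match_at a b"
proof -
  have "b < x + length a" if "x \<in> set a'" for x
    using assms(2,3) that by (cases x) auto
  then have "filter_mset (\<lambda>x. x < b) (mset (map (\<lambda>x. x + length a) a')) = {#}"
       "filter_mset (\<lambda>x. x \<le> b) (mset (map (\<lambda>x. x + length a) a')) = {#}"
    by (fastforce simp: not_less not_le)+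
  then show ?thesis unfolding match_at_mset assms(1) filter_union_mset by (simp only: add_0_right)
qed

text \<open>As \<open>b\<close> is positive, every letter of \<open>a\<close> lies strictly below
  \<open>b + length a\<close>. Both counts and the value they are compared with grow by
  \<open>length a\<close>, which cancels.\<close>

lemma match_at_shift_right:
  assumes "mset c = mset a + mset (map (\<lambda>x. x + length a) a')" "set a \<subseteq> {..length a}" "0 < b"
  shows "match_at c (b + length a) \<longleftrightarrow> match_at a' b"
proof -
  have "filter_mset (\<lambda>x. x < b + length a) (mset a) = mset a"
       "filter_mset (\<lambda>x. x \<le> b + length a) (mset a) = mset a"
    using assms(2,3) by (fastforce simp: filter_mset_eq_conv)+
  then show ?thesis unfolding match_at_mset assms(1) filter_union_mset
    by (simp add: filter_mset_image_mset)
qed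


text \<open>Each of the three conditions splits separately over the two factors.\<close>

lemma level2_biword_shuffle:
  fixes v w :: "(nat \<times> nat) list"
  assumes z: "z \<in> shuffles v (map (map_prod (\<lambda>x. x + length v) id) w)"
    and v: "fst ` set v \<subseteq> {..length v}" and w: "0 \<notin> fst ` set w"
  shows "level2_biword z \<longleftrightarrow> level2_biword v \<and> level2_biword w"
proof -
  let ?sh = "map_prod (\<lambda>x. x + length v) id :: nat \<times> nat \<Rightarrow> nat \<times> nat"
  let ?R = "\<lambda>p q :: nat \<times> nat. fst p = fst q \<longrightarrow> snd q = 1 \<longrightarrow> snd p = 1"
  have set: "set z = set v \<union> ?sh ` set w"
    using set_shuffles[OF z] by simp
  have "mset (map fst z) = mset (map fst v) + mset (map fst (map ?sh w))"
    using mset_of_shuffle[OF z] by (simp only: mset_map image_mset_union)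
  then have m: "mset (map fst z) = mset (map fst v) + mset (map (\<lambda>x. x + length (map fst v)) (map fst w))"
    by (simp add: comp_def multiset.map_comp)
  have vle: "fst p \<le> length v" if "p \<in> set v" for p using v that by auto
  have wpos: "0 < fst p" if "p \<in> set w" for p using w that by (metis gr0I imageI)
  \<comment> \<open>Both conditions on equal letters rest on this: the two factors share no value,
    since one stays at or below \<open>length v\<close> and the other above it.\<close>
  have disj: "fst p \<noteq> fst (?sh q)" if "p \<in> set v" "q \<in> set w" for p q
    using vle[OF that(1)] wpos[OF that(2)] by simp
  have "match_at (map fst z) (fst p) \<longleftrightarrow> match_at (map fst v) (fst p)" if "p \<in> set v" for p
    using match_at_shift_left[OF m] w vle[OF that] by simp
  moreover have "match_at (map fst z) (fst p + length v) \<longleftrightarrow> match_at (map fst w) (fst p)" if "p \<in> set w" for p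
    using match_at_shift_right[OF m] v wpos[OF that] by simp
  ultimately have "(\<forall>p\<in>set z. snd p = 1 \<longrightarrow> match_at (map fst z) (fst p)) \<longleftrightarrow>
      (\<forall>p\<in>set v. snd p = 1 \<longrightarrow> match_at (map fst v) (fst p)) \<and>
      (\<forall>p\<in>set w. snd p = 1 \<longrightarrow> match_at (map fst w) (fst p))"
    unfolding set ball_Un by simp
  moreover have "sorted_wrt ?R z \<longleftrightarrow> sorted_wrt ?R v \<and> sorted_wrt ?R w"
  proof -
    have R: "?R p q \<and> ?R q p" if "p \<in> set v" "q \<in> set (map ?sh w)" for p q
    proof -
      from that(2) obtain q' where "q = ?sh q'" "q' \<in> set w" by auto
      then have "fst p \<noteq> fst q" using disj[OF that(1)] by simp
      then show ?thesis by simp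
    qed
    have "sorted_wrt ?R z \<longleftrightarrow> sorted_wrt ?R v \<and> sorted_wrt ?R (map ?sh w)"
      by (rule sorted_wrt_shuffles[OF z R])
    \<comment> \<open>\<open>?R\<close> tests only equality of values and the colors; the shift is
      injective on values and fixes colors.\<close>
    also have "sorted_wrt ?R (map ?sh w) \<longleftrightarrow> sorted_wrt ?R w"
      by (simp add: sorted_wrt_map)
    finally show ?thesis .
  qed
  moreover have "(\<forall>p\<in>set z. (fst p, 0) \<in> set z) \<longleftrightarrow>
      (\<forall>p\<in>set v. (fst p, 0) \<in> set v) \<and> (\<forall>p\<in>set w. (fst p, 0) \<in> set w)"
  proof -
    \<comment> \<open>A copy of color 0 has the same value, so it must come from the same
      factor.\<close>
    have "(fst p, 0) \<in> set z \<longleftrightarrow> (fst p, 0) \<in> set v" if "p \<in> set v" for p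
      using disj[OF that] unfolding set by force
    moreover have "(fst (?sh p), 0) \<in> set z \<longleftrightarrow> (fst p, 0) \<in> set w" if "p \<in> set w" for p
      using disj[OF _ that] unfolding set by force
    ultimately show ?thesis unfolding set ball_Un by simp
  qed
  ultimately show ?thesis unfolding level2_biword_def by blast
qed

lemma level2_pf_shuffle:
  assumes "z \<in> pf_shuffle x y"
  shows "level2 z \<longleftrightarrow> level2 x \<and> level2 y"
proof -
  obtain a u where x: "Rep_colored_pf x = (a, u)" by fastforce
  obtain b v where y: "Rep_colored_pf y = (b, v)" by fastforce
  have xp: "set a \<subseteq> {1..length a}" "length u = length a"
    using Rep_colored_pf[of x] x by (auto simp: parking_function_def)
  have yp: "set b \<subseteq> {1..length b}" "length v = length b"
    using Rep_colored_pf[of y] y by (auto simp: parking_function_def)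
  obtain w where w: "Rep_colored_pf z = (map fst w, map snd w)"
      "w \<in> shuffles (zip a u) (zip (map (\<lambda>t. t + length a) b) v)"
    using assms by (auto simp: pf_shuffle_def shifted_shuffle_def x y)
  \<comment> \<open>Shifting the letters before attaching colors is the same as shifting the
    biletters.\<close>
  have "zip (map (\<lambda>t. t + length a) b) v = map (map_prod (\<lambda>t. t + length (zip a u)) id) (zip b v)"
    using xp by (simp add: zip_map1 map_prod_def)
  moreover have "fst ` set (zip a u) = set a" "fst ` set (zip b v) = set b"
    using xp yp by (simp_all flip: set_map)
  moreover have "set a \<subseteq> {..length (zip a u)}" "0 \<notin> set b"
    using xp yp by auto
  ultimately have "level2_biword w \<longleftrightarrow> level2_biword (zip a u) \<and> level2_biword (zip b v)"
    using level2_biword_shuffle[of w "zip a u" "zip b v"] w(2) by simp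
  then show ?thesis
    using xp yp w(1) by (simp add: level2_def x y flip: level2_word_iff_biword)
qed

lemma dual_mult_add:
  "dual_mult (f + f') g = dual_mult f g + dual_mult f' (g :: 'k::field pqsym2_dual)"
  "dual_mult f (g + g') = dual_mult f g + dual_mult f (g' :: 'k::field pqsym2_dual)"
  by (auto simp: fun_eq_iff dual_mult_def tensor_functional_def split_def algebra_simps sum.distrib)

lemma dual_mult_scale:
  "dual_mult (fun_scale c f) g = fun_scale c (dual_mult f (g :: 'k::field pqsym2_dual))"
  "dual_mult f (fun_scale c g) = fun_scale c (dual_mult f (g :: 'k::field pqsym2_dual))"
  by (auto simp: fun_eq_iff dual_mult_def tensor_functional_def fun_scale_def split_def
      sum_distrib_left mult_ac intro!: sum.cong)

lemma dual_mult_zero: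
  "dual_mult 0 g = (0 :: 'k::field pqsym2_dual)" "dual_mult f 0 = (0 :: 'k::field pqsym2_dual)"
  by (auto simp: fun_eq_iff dual_mult_def tensor_functional_def split_def)

text \<open>By bilinearity, closure need only be checked on generators. The induction runs over one
  factor at a time; its \<open>base\<close> case says that the admissible values of that factor form
  a subspace.\<close>

lemma dual_mult_span:
  fixes S :: "'k::field pqsym2_dual set"
  assumes "\<And>f g. f \<in> S \<Longrightarrow> g \<in> S \<Longrightarrow> dual_mult f g \<in> dual.span S"
    and f: "f \<in> dual.span S" and g: "g \<in> dual.span S"
  shows "dual_mult f g \<in> dual.span S"
  using f
proof (induction rule: dual.span_induct)
  case base
  show ?case
    by (rule dual.subspaceI)
       (auto simp: dual_mult_add dual_mult_scale dual_mult_zero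
         intro: dual.span_zero dual.span_add dual.span_scale)
next
  case (step f)
  show ?case
    using g
  proof (induction rule: dual.span_induct)
    case base
    show ?case
      by (rule dual.subspaceI)
         (auto simp: dual_mult_add dual_mult_scale dual_mult_zero
           intro: dual.span_zero dual.span_add dual.span_scale)
  qed (use assms(1) step in auto)
qed

text \<open>The vectors supported on \<open>P\<close> form a subspace containing the generators,
  hence the whole span.\<close>

lemma keys_span_G:
  assumes "v \<in> pm.span {G x | x. P x}" "x \<in> Poly_Mapping.keys (v :: 'k::field pqsym2)"
  shows "P x"
proof -
  have "\<forall>x. Poly_Mapping.lookup v x \<noteq> 0 \<longrightarrow> P x"
    using assms(1)
  proof (induction rule: pm.span_induct)
    case base
    show ?case
      by (rule pm.subspaceI) (auto simp: lookup_add, metis add.right_neutral)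
  qed (auto simp: lookup_G split: if_splits)
  then show ?thesis using assms(2) by (simp add: in_keys_iff)
qed

theorem theorem8p1:
  shows "dual_subalgebra (dual.span {F x | x. level2 x} :: 'k::field pqsym2_dual set) \<and>
         subcoalgebra (pm.span {G x | x. level2 x} :: 'k pqsym2 set)"
proof
  let ?A = "dual.span {F x | x. level2 x} :: 'k pqsym2_dual set"
  have "?A \<subseteq> graded_dual"
    unfolding graded_dual_eq_span by (rule dual.span_mono) auto
  moreover have "dual_one \<in> ?A"
    unfolding dual_one_def
    \<comment> \<open>The empty word satisfies all three conditions vacuously.\<close>
    by (rule dual.span_base) (auto simp: level2_def level2_word_def Rep_empty_pf)
  moreover have "dual_mult f g \<in> ?A" if "f \<in> ?A" "g \<in> ?A" for f g
  proof (rule dual_mult_span[OF _ that])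
    fix f g :: "'k pqsym2_dual"
    assume "f \<in> {F x | x. level2 x}" "g \<in> {F x | x. level2 x}"
    then obtain x y where "f = F x" "g = F y" "level2 x" "level2 y" by auto
    then show "dual_mult f g \<in> ?A"
      unfolding \<open>f = F x\<close> \<open>g = F y\<close> F_product
      by (intro dual.span_sum dual.span_base) (auto simp: level2_pf_shuffle)
  qed
  ultimately show "dual_subalgebra ?A"
    by (simp add: dual_subalgebra_def)
next
  let ?C = "pm.span {G x | x. level2 x} :: 'k pqsym2 set"
  let ?T = "pm.span {tensor c d | c d. c \<in> ?C \<and> d \<in> ?C}"
  \<comment> \<open>If \<open>x\<close> is level 2, so are both factors of each unshuffling, which
    puts both tensor legs in \<open>?C\<close>.\<close>
  have "tensor (G y) (G z) \<in> ?T" if "level2 x" "x \<in> pf_shuffle y z" for x y z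
    using that level2_pf_shuffle[OF that(2)] by (blast intro: pm.span_base)
  then have "coproduct_G x \<in> ?T" if "level2 x" for x
    unfolding coproduct_G_def using that by (intro pm.span_sum) auto
  \<comment> \<open>The sum defining \<open>coproduct v\<close> runs over the support of
    \<open>v\<close>, which consists of level 2 indices.\<close>
  then have "coproduct v \<in> ?T" if "v \<in> ?C" for v
    unfolding coproduct_def using keys_span_G[OF that] by (intro pm.span_sum pm.span_scale) auto
  then show "subcoalgebra ?C"
    by (simp add: subcoalgebra_def)
qed

end
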